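(* The following conditions on a semiring $(S,+,\cdot)$ are equivalent: (i) $S$ is a strongly additively quasi completely inverse semiring; (ii) $S$ is quasi completely regular and $Reg^{+}(S)$ is an additive inverse subsemiring of $S$; (iii) $S$ is quasi completely inverse and for any two elements $e,f\in E^{+}(S)$, $e+f\in E^{+}(S)$.
   Context: A semiring $(S,+,\cdot)$ is a set with two binary operations such that $(S,+)$ and $(S,\cdot)$ are semigroups (neither assumed commutative, and no zero or identity assumed) and $a(b+c)=ab+ac$, $(b+c)a=ba+ca$ for all $a,b,c\in S$. For a positive integer $n$, $na=a+\dots+a$ ($n$ times). An element $a\in S$ is additively regular if $a+x+a=a$ for some $x\in S$; $Reg^{+}(S)$ is the set of all additively regular elements. $E^{+}(S)=\{e\in S: e+e=e\}$. $S$ is additively quasi regular if for every $a\in S$ there is a positive integer $n$ such that $na$ is additively regular. $S$ is quasi completely regular if for every $a\in S$ there are a positive integer $n$ and $x\in S$ with $na=na+x+na$, $na+x=x+na$ and $na(na+x)=na+x$. $S$ is additively quasi inverse if for every $a\in S$ there are a positive integer $n$ and a unique $x\in S$ with $na+x+na=na$ and $x+na+x=x$. $S$ is quasi completely inverse if it is both quasi completely regular and additively quasi inverse. $S$ is strongly additively quasi inverse if it is additively quasi regular and $e+f=f+e$ for all $e,f\in E^+(S)$. $S$ is strongly additively quasi completely inverse if it is both quasi completely regular and strongly additively quasi inverse. A semiring is an additive inverse semiring if its additive reduct is an inverse semigroup (each $a$ has a unique $a'$ with $a+a'+a=a$, $a'+a+a'=a'$); an additive inverse subsemiring of $S$ is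 a subsemiring that is an additive inverse semiring. *)

theory Defs
  imports Main
begin

text \<open>Neither operation is assumed commutative and no neutral elements are assumed, so the
  class \<open>semiring\<close> of Main (whose addition is commutative) does not apply. Semirings are given
  by an explicit carrier because subsemirings are semirings in their own right.\<close>

locale nc_semiring =
  fixes S :: "'a set"
    and add :: "'a \<Rightarrow> 'a \<Rightarrow> 'a"  (infixl "\<oplus>" 65)
    and mult :: "'a \<Rightarrow> 'a \<Rightarrow> 'a"  (infixl "\<otimes>" 70)
  assumes add_closed: "\<lbrakk>a \<in> S; b \<in> S\<rbrakk> \<Longrightarrow> a \<oplus> b \<in> S"
    and mult_closed: "\<lbrakk>a \<in> S; b \<in> S\<rbrakk> \<Longrightarrow> a \<otimes> b \<in> S"
    and add_assoc: "\<lbrakk>a \<in> S; b \<in> S; c \<in> S\<rbrakk> \<Longrightarrow> (a \<oplus> b) \<oplus> c = a \<oplus> (b \<oplus> c)"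
    and mult_assoc: "\<lbrakk>a \<in> S; b \<in> S; c \<in> S\<rbrakk> \<Longrightarrow> (a \<otimes> b) \<otimes> c = a \<otimes> (b \<otimes> c)"
    and distrib_left: "\<lbrakk>a \<in> S; b \<in> S; c \<in> S\<rbrakk> \<Longrightarrow> a \<otimes> (b \<oplus> c) = a \<otimes> b \<oplus> a \<otimes> c"
    and distrib_right: "\<lbrakk>a \<in> S; b \<in> S; c \<in> S\<rbrakk> \<Longrightarrow> (b \<oplus> c) \<otimes> a = b \<otimes> a \<oplus> c \<otimes> a"

text \<open>The sum of \<open>n\<close> copies of \<open>a\<close>. As there need not be a zero, only \<open>n > 0\<close> is meaningful
  (the value at \<open>n = 0\<close> is \<open>a\<close>).\<close>

definition nmult :: "('a \<Rightarrow> 'a \<Rightarrow> 'a) \<Rightarrow> nat \<Rightarrow> 'a \<Rightarrow> 'a" where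
  "nmult add n a = (add a ^^ (n - 1)) a"

lemma nmult_1: "nmult add 1 a = a"
  by (simp add: nmult_def)

lemma nmult_Suc: "n > 0 \<Longrightarrow> nmult add (Suc n) a = add a (nmult add n a)"
  by (cases n) (simp_all add: nmult_def)

context nc_semiring
begin

definition additively_regular :: "'a \<Rightarrow> bool" where
  "additively_regular a \<longleftrightarrow> (\<exists>x\<in>S. a \<oplus> x \<oplus> a = a)"

definition Reg_plus :: "'a set" where
  "Reg_plus = {a \<in> S. additively_regular a}"

definition E_plus :: "'a set" where
  "E_plus = {e \<in> S. e \<oplus> e = e}"

end

locale additively_quasi_regular_semiring = nc_semiring +
  assumes quasi_regular: "a \<in> S \<Longrightarrow> \<exists>n>0. additively_regular (nmult (\<oplus>) n a)"

locale quasi_completely_regular_semiring = nc_semiring +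
  assumes quasi_completely_regular: "a \<in> S \<Longrightarrow>
    \<exists>n>0. \<exists>x\<in>S. let b = nmult (\<oplus>) n a in
      b = b \<oplus> x \<oplus> b \<and> b \<oplus> x = x \<oplus> b \<and> b \<otimes> (b \<oplus> x) = b \<oplus> x"

locale additively_quasi_inverse_semiring = nc_semiring +
  assumes quasi_inverse: "a \<in> S \<Longrightarrow>
    \<exists>n>0. \<exists>!x. x \<in> S \<and> nmult (\<oplus>) n a \<oplus> x \<oplus> nmult (\<oplus>) n a = nmult (\<oplus>) n a
      \<and> x \<oplus> nmult (\<oplus>) n a \<oplus> x = x"

locale quasi_completely_inverse_semiring =
  quasi_completely_regular_semiring + additively_quasi_inverse_semiring

locale strongly_additively_quasi_inverse_semiring = additively_quasi_regular_semiring +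
  assumes idem_commute: "\<lbrakk>e \<in> E_plus; f \<in> E_plus\<rbrakk> \<Longrightarrow> e \<oplus> f = f \<oplus> e"

locale strongly_additively_quasi_completely_inverse_semiring =
  quasi_completely_regular_semiring + strongly_additively_quasi_inverse_semiring

locale additive_inverse_semiring = nc_semiring +
  assumes unique_inverse: "a \<in> S \<Longrightarrow> \<exists>!x. x \<in> S \<and> a \<oplus> x \<oplus> a = a \<and> x \<oplus> a \<oplus> x = x"

context nc_semiring
begin

definition subsemiring :: "'a set \<Rightarrow> bool" where
  "subsemiring T \<longleftrightarrow> T \<subseteq> S \<and> nc_semiring T (\<oplus>) (\<otimes>)"

definition additive_inverse_subsemiring :: "'a set \<Rightarrow> bool" where
  "additive_inverse_subsemiring T \<longleftrightarrow> subsemiring T \<and> additive_inverse_semiring T (\<oplus>) (\<otimes>)"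

end

end

theory Submission
  imports Defs
begin

text \<open>Over a quasi completely regular semiring, each condition says that additive idempotents
  commute. If sums of idempotents are idempotent, then \<open>f \<oplus> e\<close> and \<open>e \<oplus> f\<close> are both inverses of
  \<open>e \<oplus> f\<close>, so uniqueness of inverses forces commutation; for (iii) note that \<open>ne = e\<close> for
  an idempotent \<open>e\<close>, so that the unique inverse of some multiple is one of \<open>e\<close> itself. The
  converse is the classical argument for inverse semigroups.\<close>

section \<open>Additive inverses, idempotents and regular elements\<close>

context nc_semiring
begin

text \<open>Repeats the condition under the unique-existence quantifier of
  \<open>quasi_inverse\<close>, so that unfolding passes between the two. Membership of
  \<open>a\<close> in \<open>S\<close> is left to the lemmas.\<close>

definition add_inverse :: "'a \<Rightarrow> 'a \<Rightarrow> bool" where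
  "add_inverse a x \<longleftrightarrow> x \<in> S \<and> a \<oplus> x \<oplus> a = a \<and> x \<oplus> a \<oplus> x = x"

lemma add_inverse_closed: "add_inverse a x \<Longrightarrow> x \<in> S"
  by (simp add: add_inverse_def)

lemma add_inverse_sym: "a \<in> S \<Longrightarrow> add_inverse a x \<Longrightarrow> add_inverse x a"
  by (simp add: add_inverse_def)

text \<open>Right-nested rewrite rules for use together with \<open>add_assoc\<close>. The versions
  with \<open>z\<close> are needed because, after reassociation, the pattern at the head of a longer
  sum is no longer a subterm by itself.\<close>

lemma add_inverse_cancel:
  assumes "a \<in> S" "add_inverse a x"
  shows "a \<oplus> (x \<oplus> a) = a"
    and "x \<oplus> (a \<oplus> x) = x"
    and "z \<in> S \<Longrightarrow> a \<oplus> (x \<oplus> (a \<oplus> z)) = a \<oplus> z"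
    and "z \<in> S \<Longrightarrow> x \<oplus> (a \<oplus> (x \<oplus> z)) = x \<oplus> z"
proof -
  have x: "x \<in> S" and axa: "a \<oplus> x \<oplus> a = a" and xax: "x \<oplus> a \<oplus> x = x"
    using assms by (simp_all add: add_inverse_def)
  show "a \<oplus> (x \<oplus> a) = a" "x \<oplus> (a \<oplus> x) = x"
    using assms(1) x axa xax by (simp_all add: add_assoc)
  show "a \<oplus> (x \<oplus> (a \<oplus> z)) = a \<oplus> z" if "z \<in> S"
    using arg_cong[OF axa, of "\<lambda>t. t \<oplus> z"] assms(1) x that by (simp add: add_assoc add_closed)
  show "x \<oplus> (a \<oplus> (x \<oplus> z)) = x \<oplus> z" if "z \<in> S"
    using arg_cong[OF xax, of "\<lambda>t. t \<oplus> z"] assms(1) x that by (simp add: add_assoc add_closed)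
qed

lemma add_inverse_idem:
  assumes "a \<in> S" "add_inverse a x"
  shows "a \<oplus> x \<in> E_plus"
  using assms add_inverse_closed[OF assms(2)]
  by (simp add: E_plus_def add_closed add_assoc add_inverse_cancel)

lemma E_plus_add_inverse: "e \<in> E_plus \<Longrightarrow> add_inverse e e"
  by (simp add: E_plus_def add_inverse_def)

lemma E_plus_closed: "e \<in> E_plus \<Longrightarrow> e \<in> S"
  by (simp add: E_plus_def)

lemma E_plus_cancel:
  assumes "e \<in> E_plus"
  shows "e \<oplus> e = e" and "z \<in> S \<Longrightarrow> e \<oplus> (e \<oplus> z) = e \<oplus> z"
  using assms add_assoc[of e e z] by (auto simp: E_plus_def)

text \<open>If \<open>a \<oplus> x \<oplus> a = a\<close>, then
  \<open>x \<oplus> a \<oplus> x\<close> satisfies both inverse equations.\<close>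

lemma additively_regular_iff:
  assumes a: "a \<in> S"
  shows "additively_regular a \<longleftrightarrow> (\<exists>x. add_inverse a x)"
proof
  assume "additively_regular a"
  then obtain x where x: "x \<in> S" and axa: "a \<oplus> x \<oplus> a = a"
    by (auto simp: additively_regular_def)
  have absorb: "a \<oplus> (x \<oplus> (a \<oplus> z)) = a \<oplus> z" if "z \<in> S" for z
    using arg_cong[OF axa, of "\<lambda>t. t \<oplus> z"] a x that by (simp add: add_assoc add_closed)
  have "add_inverse a (x \<oplus> a \<oplus> x)"
    using a x by (simp add: add_inverse_def add_closed add_assoc absorb axa[unfolded add_assoc[OF a x a]])
  then show "\<exists>x. add_inverse a x" ..
qed (auto simp: additively_regular_def add_inverse_def)

lemma Reg_plus_iff: "a \<in> Reg_plus \<longleftrightarrow> a \<in> S \<and> (\<exists>x. add_inverse a x)"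
  using additively_regular_iff by (auto simp: Reg_plus_def)

text \<open>Being an inverse is symmetric, so searching for inverses in \<open>S\<close> or in
  \<open>Reg_plus\<close> gives the same elements.\<close>

lemma add_inverse_Reg_plus: "a \<in> S \<Longrightarrow> add_inverse a x \<Longrightarrow> x \<in> Reg_plus"
  using Reg_plus_iff add_inverse_closed add_inverse_sym by blast

lemma E_plus_Reg_plus: "e \<in> E_plus \<Longrightarrow> e \<in> Reg_plus"
  using E_plus_add_inverse E_plus_closed Reg_plus_iff by blast

text \<open>Multiply \<open>a \<oplus> x \<oplus> a = a\<close> by \<open>b\<close> on the right and
  distribute: \<open>x \<otimes> b\<close> is the witness.\<close>

lemma Reg_plus_mult_closed:
  assumes "a \<in> Reg_plus" "b \<in> Reg_plus"
  shows "a \<otimes> b \<in> Reg_plus"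
proof -
  obtain x where "x \<in> S" "a \<oplus> x \<oplus> a = a" and "a \<in> S" "b \<in> S"
    using assms by (auto simp: Reg_plus_def additively_regular_def)
  then have "a \<otimes> b \<oplus> x \<otimes> b \<oplus> a \<otimes> b = a \<otimes> b"
    by (metis add_closed distrib_right)
  with \<open>x \<in> S\<close> \<open>a \<in> S\<close> \<open>b \<in> S\<close> show ?thesis
    by (auto simp: Reg_plus_def additively_regular_def mult_closed)
qed

section \<open>Multiples of an element\<close>

lemma nmult_closed:
  assumes "n > 0" "a \<in> S"
  shows "nmult (\<oplus>) n a \<in> S"
  using assms(1)
proof (induction n rule: nat_induct_non_zero)
  case 1
  show ?case using assms(2) by (simp add: nmult_def)
next
  case (Suc n)
  then show ?case using assms(2) by (simp add: nmult_Suc add_closed)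
qed

lemma nmult_idem:
  assumes "n > 0" "e \<in> E_plus"
  shows "nmult (\<oplus>) n e = e"
  using assms(1)
proof (induction n rule: nat_induct_non_zero)
  case 1
  show ?case by (simp add: nmult_def)
next
  case (Suc n)
  then show ?case using assms(2) by (simp add: nmult_Suc E_plus_def)
qed

section \<open>Consequences of commuting idempotents\<close>

lemma E_plus_add_closed_if_commute:
  assumes comm: "\<And>e f. e \<in> E_plus \<Longrightarrow> f \<in> E_plus \<Longrightarrow> e \<oplus> f = f \<oplus> e"
    and e: "e \<in> E_plus" and f: "f \<in> E_plus"
  shows "e \<oplus> f \<in> E_plus"
proof -
  have S: "e \<in> S" "f \<in> S" using e f E_plus_closed by auto
  have "(e \<oplus> f) \<oplus> (e \<oplus> f) = e \<oplus> (f \<oplus> e) \<oplus> f"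
    using S by (simp add: add_assoc add_closed)
  also have "\<dots> = e \<oplus> (e \<oplus> f) \<oplus> f"
    by (simp add: comm[OF e f])
  also have "\<dots> = e \<oplus> f"
    using S e f by (simp add: add_assoc add_closed E_plus_cancel)
  finally show ?thesis using S by (simp add: E_plus_def add_closed)
qed

text \<open>Swapping \<open>a \<oplus> x\<close> with \<open>a \<oplus> y\<close> turns
  \<open>x\<close> into \<open>x \<oplus> a \<oplus> y\<close>; swapping \<open>x \<oplus> a\<close>
  with \<open>y \<oplus> a\<close> turns that into \<open>y\<close>.\<close>

lemma add_inverse_unique_if_commute:
  assumes comm: "\<And>e f. e \<in> E_plus \<Longrightarrow> f \<in> E_plus \<Longrightarrow> e \<oplus> f = f \<oplus> e"
    and a: "a \<in> S" and x: "add_inverse a x" and y: "add_inverse a y"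
  shows "x = y"
proof -
  have S: "x \<in> S" "y \<in> S" using x y add_inverse_closed by auto
  note simps = a S add_assoc add_closed add_inverse_cancel[OF a x] add_inverse_cancel[OF a y]
  have "x = x \<oplus> ((a \<oplus> y) \<oplus> (a \<oplus> x))"
    by (simp add: simps)
  also have "\<dots> = x \<oplus> ((a \<oplus> x) \<oplus> (a \<oplus> y))"
    by (simp only: comm[OF add_inverse_idem[OF a y] add_inverse_idem[OF a x]])
  \<comment> \<open>Both sides cancel to \<open>x \<oplus> (a \<oplus> y)\<close>; the right-hand
    side is expanded to expose the second pair of idempotents.\<close>
  also have "\<dots> = ((x \<oplus> a) \<oplus> (y \<oplus> a)) \<oplus> y"
    by (simp add: simps)
  also have "\<dots> = ((y \<oplus> a) \<oplus> (x \<oplus> a)) \<oplus> y"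
    by (simp only: comm[OF add_inverse_idem[OF S(1) add_inverse_sym[OF a x]]
          add_inverse_idem[OF S(2) add_inverse_sym[OF a y]]])
  also have "\<dots> = y"
    by (simp add: simps)
  finally show ?thesis .
qed

text \<open>The reversed sum \<open>y \<oplus> x\<close> of inverses is the witness: the idempotents
  \<open>b \<oplus> y\<close> and \<open>x \<oplus> a\<close> meet in the middle, and once swapped
  each is absorbed by its neighbour.\<close>

lemma Reg_plus_add_closed_if_commute:
  assumes comm: "\<And>e f. e \<in> E_plus \<Longrightarrow> f \<in> E_plus \<Longrightarrow> e \<oplus> f = f \<oplus> e"
    and ab: "a \<in> Reg_plus" "b \<in> Reg_plus"
  shows "a \<oplus> b \<in> Reg_plus"
proof -
  obtain x y where a: "a \<in> S" and b: "b \<in> S" and x: "add_inverse a x" and y: "add_inverse b y"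
    using ab Reg_plus_iff by blast
  have S: "x \<in> S" "y \<in> S" using x y add_inverse_closed by auto
  note simps = a b S add_assoc add_closed add_inverse_cancel[OF a x] add_inverse_cancel[OF b y]
  have "(a \<oplus> b) \<oplus> (y \<oplus> x) \<oplus> (a \<oplus> b) = a \<oplus> ((b \<oplus> y) \<oplus> (x \<oplus> a)) \<oplus> b"
    by (simp add: simps)
  also have "\<dots> = a \<oplus> ((x \<oplus> a) \<oplus> (b \<oplus> y)) \<oplus> b"
    by (simp only: comm[OF add_inverse_idem[OF b y]
          add_inverse_idem[OF S(1) add_inverse_sym[OF a x]]])
  also have "\<dots> = a \<oplus> b"
    by (simp add: simps)
  finally show ?thesis
    using a b S by (auto simp: Reg_plus_def additively_regular_def add_closed)
qed

lemma additive_inverse_subsemiring_Reg_plus: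
  assumes comm: "\<And>e f. e \<in> E_plus \<Longrightarrow> f \<in> E_plus \<Longrightarrow> e \<oplus> f = f \<oplus> e"
  shows "additive_inverse_subsemiring Reg_plus"
proof -
  have sub: "Reg_plus \<subseteq> S" by (auto simp: Reg_plus_def)
  have semi: "nc_semiring Reg_plus (\<oplus>) (\<otimes>)"
    by unfold_locales
      (use sub in \<open>auto simp: Reg_plus_add_closed_if_commute[OF comm] Reg_plus_mult_closed
        add_assoc mult_assoc distrib_left distrib_right subset_iff\<close>)
  have "\<exists>!x. x \<in> Reg_plus \<and> a \<oplus> x \<oplus> a = a \<and> x \<oplus> a \<oplus> x = x" if "a \<in> Reg_plus" for a
  proof -
    obtain x where a: "a \<in> S" and x: "add_inverse a x"
      using \<open>a \<in> Reg_plus\<close> Reg_plus_iff by blast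
    show ?thesis
    proof (rule ex1I[of _ x])
      show "x \<in> Reg_plus \<and> a \<oplus> x \<oplus> a = a \<and> x \<oplus> a \<oplus> x = x"
        using add_inverse_Reg_plus[OF a x] x by (simp add: add_inverse_def)
      show "y = x" if "y \<in> Reg_plus \<and> a \<oplus> y \<oplus> a = a \<and> y \<oplus> a \<oplus> y = y" for y
        using add_inverse_unique_if_commute[OF comm a _ x] that sub
        by (auto simp: add_inverse_def)
    qed
  qed
  with semi sub show ?thesis
    by (simp add: additive_inverse_subsemiring_def subsemiring_def additive_inverse_semiring_def
        additive_inverse_semiring_axioms_def)
qed

section \<open>Commutation recovered from uniqueness of inverses\<close>

text \<open>Uniqueness is demanded only among idempotent inverses, so that the lemma applies both
  when inverses are unique in \<open>S\<close> and when they are unique in \<open>Reg_plus\<close>,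
  which contains all idempotents.\<close>

lemma E_plus_commute_if_sum_unique_inverse:
  assumes e: "e \<in> E_plus" and f: "f \<in> E_plus"
    and ef: "e \<oplus> f \<in> E_plus" and fe: "f \<oplus> e \<in> E_plus"
    and unique: "\<And>x y. x \<in> E_plus \<Longrightarrow> y \<in> E_plus \<Longrightarrow> add_inverse (e \<oplus> f) x
      \<Longrightarrow> add_inverse (e \<oplus> f) y \<Longrightarrow> x = y"
  shows "e \<oplus> f = f \<oplus> e"
proof (rule unique)
  have S: "e \<in> S" "f \<in> S" using e f E_plus_closed by auto
  have "e \<oplus> (f \<oplus> (e \<oplus> f)) = e \<oplus> f" "f \<oplus> (e \<oplus> (f \<oplus> e)) = f \<oplus> e"
    using S E_plus_cancel(1)[OF ef] E_plus_cancel(1)[OF fe] by (simp_all add: add_assoc add_closed)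
  then show "add_inverse (e \<oplus> f) (f \<oplus> e)"
    using S by (simp add: add_inverse_def add_assoc add_closed E_plus_cancel(2)[OF e]
        E_plus_cancel(2)[OF f])
qed (use e f ef fe E_plus_add_inverse in auto)

text \<open>The inverse \<open>x\<close> of \<open>e \<oplus> f\<close> equals the idempotent \<open>f \<oplus> x \<oplus> e\<close>, which is also an inverse;
  hence \<open>e \<oplus> f\<close>, being the inverse of an idempotent, is that idempotent.\<close>

lemma E_plus_add_closed_if_Reg_plus_inverse:
  assumes "additive_inverse_subsemiring Reg_plus"
    and e: "e \<in> E_plus" and f: "f \<in> E_plus"
  shows "e \<oplus> f \<in> E_plus"
proof -
  interpret R: additive_inverse_semiring Reg_plus "(\<oplus>)" "(\<otimes>)"
    using assms(1) by (simp add: additive_inverse_subsemiring_def)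
  have unique: "x = y" if "a \<in> Reg_plus" "x \<in> Reg_plus" "y \<in> Reg_plus"
    "add_inverse a x" "add_inverse a y" for a x y
    using R.unique_inverse[OF \<open>a \<in> Reg_plus\<close>] that by (auto simp: add_inverse_def)
  have R: "e \<in> Reg_plus" "f \<in> Reg_plus" using e f E_plus_Reg_plus by auto
  have S: "e \<in> S" "f \<in> S" using e f E_plus_closed by auto
  have efR: "e \<oplus> f \<in> Reg_plus" using R by (rule R.add_closed)
  then obtain x where efS: "e \<oplus> f \<in> S" and x: "add_inverse (e \<oplus> f) x"
    using Reg_plus_iff by blast
  have xS: "x \<in> S" and xR: "x \<in> Reg_plus"
    using x efS add_inverse_closed add_inverse_Reg_plus by auto
  note simps = S xS add_assoc add_closed
  \<comment> \<open>The rules for the inverse pair contain \<open>e \<oplus> f\<close> as a unit;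
    reassociating them lets them match fully right-nested sums.\<close>
  note cancel = E_plus_cancel[OF e] E_plus_cancel[OF f] add_inverse_cancel[OF efS x, simplified simps]
  have "add_inverse (e \<oplus> f) (f \<oplus> x \<oplus> e)"
    using cancel by (simp add: add_inverse_def simps)
  then have x_eq: "f \<oplus> x \<oplus> e = x"
    using unique[OF efR _ xR _ x] R xR R.add_closed by blast
  have "(f \<oplus> x \<oplus> e) \<oplus> (f \<oplus> x \<oplus> e) = f \<oplus> x \<oplus> e"
    using cancel by (simp add: simps)
  then have "x \<in> E_plus"
    using xS by (simp add: x_eq E_plus_def)
  moreover have "e \<oplus> f = x"
    using unique[OF xR efR xR add_inverse_sym[OF efS x]] E_plus_add_inverse[OF \<open>x \<in> E_plus\<close>] by blast
  ultimately show ?thesis by simp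
qed

lemma E_plus_commute_if_Reg_plus_inverse:
  assumes inv: "additive_inverse_subsemiring Reg_plus"
    and e: "e \<in> E_plus" and f: "f \<in> E_plus"
  shows "e \<oplus> f = f \<oplus> e"
proof (rule E_plus_commute_if_sum_unique_inverse[OF e f])
  show ef: "e \<oplus> f \<in> E_plus" and "f \<oplus> e \<in> E_plus"
    using E_plus_add_closed_if_Reg_plus_inverse[OF inv] e f by auto
  interpret R: additive_inverse_semiring Reg_plus "(\<oplus>)" "(\<otimes>)"
    using inv by (simp add: additive_inverse_subsemiring_def)
  show "x = y" if "x \<in> E_plus" "y \<in> E_plus" "add_inverse (e \<oplus> f) x" "add_inverse (e \<oplus> f) y" for x y
    using R.unique_inverse[OF E_plus_Reg_plus[OF ef]] that E_plus_Reg_plus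
    by (auto simp: add_inverse_def)
qed

end

section \<open>Idempotents of additively quasi inverse semirings\<close>

context additively_quasi_inverse_semiring
begin

lemma E_plus_add_inverse_unique:
  assumes e: "e \<in> E_plus" and "add_inverse e x" "add_inverse e y"
  shows "x = y"
proof -
  obtain n where "n > 0" and "\<exists>!x. add_inverse (nmult (\<oplus>) n e) x"
    using quasi_inverse[OF E_plus_closed[OF e]] unfolding add_inverse_def by metis
  then show ?thesis
    using assms(2,3) nmult_idem[OF \<open>n > 0\<close> e] by auto
qed

lemma E_plus_commute_if_add_closed:
  assumes closed: "\<And>e f. e \<in> E_plus \<Longrightarrow> f \<in> E_plus \<Longrightarrow> e \<oplus> f \<in> E_plus"
    and e: "e \<in> E_plus" and f: "f \<in> E_plus"
  shows "e \<oplus> f = f \<oplus> e"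
  by (rule E_plus_commute_if_sum_unique_inverse[OF e f closed[OF e f] closed[OF f e]])
    (rule E_plus_add_inverse_unique[OF closed[OF e f]])

end

section \<open>Reductions under quasi complete regularity\<close>

context quasi_completely_regular_semiring
begin

text \<open>The first conjunct of quasi complete regularity is additive regularity with the same
  \<open>n\<close> and \<open>x\<close>.\<close>

lemma quasi_regular_semiring: "additively_quasi_regular_semiring S (\<oplus>) (\<otimes>)"
proof unfold_locales
  fix a assume "a \<in> S"
  then show "\<exists>n>0. additively_regular (nmult (\<oplus>) n a)"
    using quasi_completely_regular[of a] by (metis additively_regular_def)
qed

lemma strongly_iff:
  "strongly_additively_quasi_completely_inverse_semiring S (\<oplus>) (\<otimes>)
    \<longleftrightarrow> (\<forall>e\<in>E_plus. \<forall>f\<in>E_plus. e \<oplus> f = f \<oplus> e)"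
  using quasi_regular_semiring quasi_completely_regular_semiring_axioms
  by (auto simp: strongly_additively_quasi_completely_inverse_semiring_def
      strongly_additively_quasi_inverse_semiring_def
      strongly_additively_quasi_inverse_semiring_axioms_def)

text \<open>Quasi regularity supplies a regular multiple, hence one with an inverse, and commutation
  makes that inverse unique.\<close>

lemma quasi_completely_inverse_if_commute:
  assumes comm: "\<And>e f. e \<in> E_plus \<Longrightarrow> f \<in> E_plus \<Longrightarrow> e \<oplus> f = f \<oplus> e"
  shows "quasi_completely_inverse_semiring S (\<oplus>) (\<otimes>)"
proof unfold_locales
  interpret additively_quasi_regular_semiring S "(\<oplus>)" "(\<otimes>)"
    by (rule quasi_regular_semiring)
  fix a assume a: "a \<in> S"
  then obtain n where n: "n > 0" and reg: "additively_regular (nmult (\<oplus>) n a)"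
    using quasi_regular by blast
  have "nmult (\<oplus>) n a \<in> S"
    using n a by (rule nmult_closed)
  then have "\<exists>!x. add_inverse (nmult (\<oplus>) n a) x"
    using reg additively_regular_iff add_inverse_unique_if_commute[OF comm] by blast
  with n show "\<exists>n>0. \<exists>!x. x \<in> S \<and> nmult (\<oplus>) n a \<oplus> x \<oplus> nmult (\<oplus>) n a = nmult (\<oplus>) n a
      \<and> x \<oplus> nmult (\<oplus>) n a \<oplus> x = x"
    unfolding add_inverse_def by blast
qed

end

theorem theorem4p3:
  fixes S :: "'a set"
    and add :: "'a \<Rightarrow> 'a \<Rightarrow> 'a"
    and mult :: "'a \<Rightarrow> 'a \<Rightarrow> 'a"
  assumes "nc_semiring S add mult"
  shows "(strongly_additively_quasi_completely_inverse_semiring S add mult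
      \<longleftrightarrow> quasi_completely_regular_semiring S add mult
        \<and> nc_semiring.additive_inverse_subsemiring S add mult (nc_semiring.Reg_plus S add))
    \<and> (quasi_completely_regular_semiring S add mult
        \<and> nc_semiring.additive_inverse_subsemiring S add mult (nc_semiring.Reg_plus S add)
      \<longleftrightarrow> quasi_completely_inverse_semiring S add mult
        \<and> (\<forall>e \<in> nc_semiring.E_plus S add. \<forall>f \<in> nc_semiring.E_plus S add.
             add e f \<in> nc_semiring.E_plus S add))"
\<comment> \<open>Each of the three conditions includes quasi complete regularity, so all are false
  when it fails. When it holds, each is shown equivalent to \<open>?comm\<close>.\<close>
proof (cases "quasi_completely_regular_semiring S add mult")
  case True
  then interpret quasi_completely_regular_semiring S add mult .
  let ?comm = "\<forall>e\<in>E_plus. \<forall>f\<in>E_plus. add e f = add f e"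
  have "additive_inverse_subsemiring Reg_plus \<longleftrightarrow> ?comm"
  proof
    assume ?comm
    then show "additive_inverse_subsemiring Reg_plus"
      by (intro additive_inverse_subsemiring_Reg_plus) simp
  qed (simp add: E_plus_commute_if_Reg_plus_inverse)
  moreover have "quasi_completely_inverse_semiring S add mult
      \<and> (\<forall>e\<in>E_plus. \<forall>f\<in>E_plus. add e f \<in> E_plus) \<longleftrightarrow> ?comm"
    (is "?inv \<and> ?closed \<longleftrightarrow> _")
  proof
    assume asm: "?inv \<and> ?closed"
    then interpret quasi_completely_inverse_semiring S add mult by simp
    show ?comm
      using asm E_plus_commute_if_add_closed by simp
  next
    assume ?comm
    then show "?inv \<and> ?closed"
      using quasi_completely_inverse_if_commute E_plus_add_closed_if_commute by simp
  qed
  ultimately show ?thesis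
    using True strongly_iff by blast
next
  case False
  then show ?thesis
    by (simp add: strongly_additively_quasi_completely_inverse_semiring_def
        quasi_completely_inverse_semiring_def)
qed

end
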